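(* Let $(p_{k,l})_{-1\le k,l\le 1}$ be nonnegative numbers with $\sum_{k,l}p_{k,l}=1$, and let $(X,Y)=(X(n),Y(n))_{n\ge 0}$ be a Markov chain on $\mathbb{Z}_+^2=\{0,1,2,\dots\}^2$ which, from every state $(i,j)$ with $i,j\ge 1$, jumps to $(i+k,j+l)$ with probability $p_{k,l}$. Assume: (H2) in the list $p_{1,1},p_{1,0},p_{1,-1},p_{0,-1},p_{-1,-1},p_{-1,0},p_{-1,1},p_{0,1}$ there are no three consecutive zeros; (H3) $p_{1,1}+p_{-1,1}+p_{-1,-1}+p_{1,-1}<1$; and that both drifts vanish: $\sum_{k,l} k\,p_{k,l}=0$ and $\sum_{k,l} l\,p_{k,l}=0$. Then there exists a constant $A\in(0,\infty)$ such that for every fixed $j_0\ge 1$, $$\mathbb{P}_{(i_0,j_0)}[(X,Y)\text{ hits }\mathcal{V}\text{ before }\mathcal{H}^*]\sim A\,\frac{j_0}{i_0},\qquad i_0\to\infty.$$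
   Context: $\mathbb{P}_{(i_0,j_0)}$ denotes probability for the chain started at $(i_0,j_0)$ with $i_0,j_0\ge1$. $\mathcal{H}=\{(i,0):i\ge 0\}$, $\mathcal{V}=\{(0,j):j\ge 0\}$, $\mathcal{H}^*=\mathcal{H}\setminus\{(0,0)\}$. The event "$(X,Y)$ hits $\mathcal{V}$ before $\mathcal{H}^*$" means that the first point of $\mathcal{H}\cup\mathcal{V}$ visited by the chain lies in $\mathcal{V}$ (the behaviour of the chain on the axes is irrelevant). *)

theory Defs
  imports "HOL-Analysis.Analysis" "HOL-Library.Landau_Symbols"
begin

text \<open>Transition probabilities p k l for k, l in {-1,0,1}. States are pairs of integers
 (i,j) in Z_+^2. From an interior state (i \<ge> 1, j \<ge> 1) the chain moves to (i+k, j+l)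
 with probability p k l.  hit_V_within p n i j is the probability that the chain started
 at (i,j) has hit the set V = {(0,j)} within n steps, before hitting H* = {(i,0) : i \<ge> 1}
 (i.e. the first point of H \<union> V visited lies in V, and is visited at time \<le> n).
 Behaviour on the axes is irrelevant, so the recursion stops there.\<close>

fun hit_V_within :: "(int \<Rightarrow> int \<Rightarrow> real) \<Rightarrow> nat \<Rightarrow> int \<Rightarrow> int \<Rightarrow> real" where
  "hit_V_within p 0 i j = (if i = 0 then 1 else 0)"
| "hit_V_within p (Suc n) i j =
     (if i = 0 then 1 else if j = 0 then 0
      else (\<Sum>k\<in>{-1,0,1}. \<Sum>l\<in>{-1,0,1}. p k l * hit_V_within p n (i + k) (j + l)))"

definition hit_V_before_H :: "(int \<Rightarrow> int \<Rightarrow> real) \<Rightarrow> int \<Rightarrow> int \<Rightarrow> real" where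
  "hit_V_before_H p i j = (SUP n. hit_V_within p n i j)"

end

theory Submission
  imports Defs
begin

text \<open>
  Choose \<open>\<beta>\<close> in the upper half plane such that, for a jump \<open>(k, l)\<close>, the mean of
  \<open>(k + \<beta> l)\<^sup>2\<close> vanishes; the mean of \<open>k + \<beta> l\<close> vanishes anyway. In the coordinate \<open>z = i + \<beta> j\<close> the generator of the walk
  is then a multiple of the Laplacian up to third-order errors, so the harmonic function
  \<open>u = Arg z / Arg \<beta>\<close>, which is 0 on the horizontal and 1 on the vertical axis, is harmonic for the
  walk up to \<open>O(1/|z|\<^sup>3)\<close>. With \<open>\<theta> = Arg z\<close>, the barrier
  \<open>w = (a sin \<theta> - (1 - cos \<theta>)) / |z|\<close> is nonnegative on the quadrant for large \<open>a\<close>, is comparable to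
  \<open>j / |z|\<^sup>2\<close>, and has Laplacian \<open>- 1/|z|\<^sup>3\<close>. Hence \<open>u - K w\<close> and \<open>u + K w\<close> are sub- and
  superharmonic away from the origin; near the origin, where \<open>j \<ge> 1\<close> keeps \<open>w\<close> away from 0, they are
  below 0 and above 1 once \<open>K\<close> is large. The maximum principle squeezes the hitting probability between
  them, and \<open>u \<sim> Im \<beta> j / (i Arg \<beta>)\<close> while \<open>w = O(j / i\<^sup>2)\<close>.
\<close>

section \<open>Expansions in the complex plane\<close>

text \<open>Second-order Taylor formula on the disc of radius 1/2: there \<open>cmod (1 + x)\<close>
  is at least 1/2, so the third derivative \<open>2 / (1 + x)^3\<close> is at most 16 in modulus.
  The function \<open>f\<close> lists \<open>Ln (1 + x)\<close> and its first three
  derivatives.\<close>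

lemma Ln_one_plus_approx:
  fixes q :: complex
  assumes "cmod q \<le> 1/2"
  shows "cmod (Ln (1 + q) - q + q\<^sup>2 / 2) \<le> 8 * cmod q ^ 3"
proof -
  define f :: "nat \<Rightarrow> complex \<Rightarrow> complex" where
    "f = (\<lambda>i x. if i = 0 then Ln (1 + x) else if i = 1 then 1 / (1 + x)
            else if i = 2 then - 1 / (1 + x)^2 else 2 / (1 + x)^3)"
  have half: "cmod (1 + x) \<ge> 1/2" if "x \<in> cball 0 (1/2)" for x
    using that norm_diff_ineq[of 1 x] by simp
  have "cmod (f 0 q - (\<Sum>i\<le>2. f i 0 * (q - 0) ^ i / fact i)) \<le> 16 * cmod (q - 0) ^ Suc 2 / fact 2"
  proof (rule complex_Taylor[where S = "cball 0 (1/2)"])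
    show "(f i has_field_derivative f (Suc i) x) (at x within cball 0 (1/2))"
      if x: "x \<in> cball 0 (1/2)" and "i \<le> 2" for i x
    proof -
      have nz: "1 + x \<noteq> 0" using half[OF x] by auto
      have "\<bar>Re x\<bar> \<le> 1/2" using x abs_Re_le_cmod[of x] by simp
      then have "1 + x \<notin> \<real>\<^sub>\<le>\<^sub>0" by (auto simp: complex_nonpos_Reals_iff)
      then have d0: "((\<lambda>x. Ln (1 + x)) has_field_derivative 1 / (1 + x)) (at x within cball 0 (1/2))"
        by (auto intro!: derivative_eq_intros simp: inverse_eq_divide)
      have d1: "((\<lambda>x. 1 / (1 + x)) has_field_derivative - 1 / (1 + x)^2) (at x within cball 0 (1/2))"
        using nz by (auto intro!: derivative_eq_intros simp: power2_eq_square)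
      have d2: "((\<lambda>x. - 1 / (1 + x)^2) has_field_derivative 2 / (1 + x)^3) (at x within cball 0 (1/2))"
        using nz by (auto intro!: derivative_eq_intros simp: divide_simps power2_eq_square power3_eq_cube)
      consider "i = 0" | "i = 1" | "i = 2" using \<open>i \<le> 2\<close> by linarith
      then show ?thesis
        using d0 d1 d2 by cases (auto simp: f_def)
    qed
    show "cmod (f (Suc 2) x) \<le> 16" if "x \<in> cball 0 (1/2)" for x
    proof -
      have "(1/2)^3 \<le> cmod (1 + x) ^ 3" using half[OF that] by (intro power_mono) auto
      then have "2 / cmod (1 + x) ^ 3 \<le> 2 / (1/2)^3"
        using half[OF that] by (intro divide_left_mono) (auto intro!: mult_pos_pos)
      then show ?thesis by (simp add: f_def norm_divide norm_mult power3_eq_cube)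
    qed
  qed (use assms in auto)
  moreover have "(\<Sum>i\<le>2. f i 0 * (q - 0) ^ i / fact i) = q - q\<^sup>2 / 2"
    by (simp add: f_def eval_nat_numeral)
  ultimately show ?thesis by (simp add: f_def eval_nat_numeral algebra_simps)
qed

text \<open>The error is exactly \<open>- (q^3 / (1 + q))\<close>, and \<open>cmod (1 + q)\<close>
  is at least 1/2.\<close>

lemma inverse_one_plus_approx:
  fixes q :: complex
  assumes "cmod q \<le> 1/2"
  shows "cmod (1 / (1 + q) - (1 - q + q\<^sup>2)) \<le> 2 * cmod q ^ 3"
proof -
  have h: "cmod (1 + q) \<ge> 1/2" using assms norm_diff_ineq[of 1 q] by simp
  then have nz: "1 + q \<noteq> 0" by auto
  then have "1 / (1 + q) - (1 - q + q\<^sup>2) = - (q^3 / (1 + q))"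
    by (simp add: divide_simps) (simp add: algebra_simps power2_eq_square power3_eq_cube)
  moreover have "cmod q ^ 3 / cmod (1 + q) \<le> cmod q ^ 3 / (1/2)"
    using h by (intro divide_left_mono) (auto intro!: mult_pos_pos simp: nz)
  ultimately show ?thesis by (simp add: norm_divide norm_power)
qed

text \<open>With \<open>t = cmod (1 + q)\<close> and \<open>t\<^sup>2 = 1 + s\<close>, the function
  \<open>(1 + s)\<close> to the power -1/2 lies above its cubic Taylor polynomial at 0. The
  quadratic part is split into \<open>Re (q\<^sup>2)\<close>, whose mean will vanish, and
  \<open>(cmod q)\<^sup>2\<close>, whose mean will not.\<close>

lemma inverse_cmod_one_plus_lower:
  fixes q :: complex
  assumes "cmod q \<le> 1/2"
  shows "1 / cmod (1 + q) \<ge> 1 - Re q + 3/4 * Re (q\<^sup>2) + (cmod q)\<^sup>2 / 4 - 7 * cmod q ^ 3"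
proof -
  define t where "t = cmod (1 + q)"
  define r where "r = cmod q"
  define s where "s = 2 * Re q + r\<^sup>2"
  have h: "t \<ge> 1/2" using assms norm_diff_ineq[of 1 q] by (simp add: t_def)
  have r: "0 \<le> r" "r \<le> 1/2" "\<bar>Re q\<bar> \<le> r" using assms abs_Re_le_cmod[of q] by (auto simp: r_def)
  have r2: "r\<^sup>2 = (Re q)\<^sup>2 + (Im q)\<^sup>2" unfolding r_def by (rule cmod_power2)
  have ts: "t\<^sup>2 = 1 + s"
    unfolding t_def cmod_power2 s_def r2 by (simp add: power2_eq_square algebra_simps)
  \<comment> \<open>The cubic Taylor polynomial in \<open>s\<close>, rewritten in \<open>t\<close>,
    agrees with \<open>1 / t\<close> to third order at \<open>t = 1\<close>; hence the factor
    \<open>(t - 1)^4\<close>, with a cofactor that is positive for \<open>t > 0\<close>.\<close>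
  have "16 - t * (35 - 35 * t^2 + 21 * t^4 - 5 * t^6) = (t - 1)^4 * (5 * t^3 + 20 * t^2 + 29 * t + 16)"
    by (simp add: power2_eq_square power3_eq_cube power4_eq_xxxx eval_nat_numeral algebra_simps)
  also have "\<dots> \<ge> 0" using h by (intro mult_nonneg_nonneg) auto
  finally have "(35 - 35 * t^2 + 21 * t^4 - 5 * t^6) / 16 \<le> 1 / t"
    using h by (simp add: field_simps)
  also have "(35 - 35 * t^2 + 21 * t^4 - 5 * t^6) / 16 = 1 - s/2 + 3/8 * s\<^sup>2 - 5/16 * s^3"
  proof -
    have "t^4 = (1+s)^2" "t^6 = (1+s)^3"
      by (simp_all flip: ts power_mult)
    then show ?thesis using ts by (simp add: field_simps power2_eq_square power3_eq_cube)
  qed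
  finally have main: "1 - s/2 + 3/8 * s\<^sup>2 - 5/16 * s^3 \<le> 1 / t" .
  \<comment> \<open>The cubic term costs at most \<open>5 * r^3\<close>, and the cross term in
    \<open>s\<^sup>2\<close> costs 3/8 of \<open>4 * r^3\<close>; together they stay below the
    allowed \<open>7 * r^3\<close>.\<close>
  have rr: "r * r \<le> 1/2 * r" using r by (intro mult_right_mono) auto
  have "\<bar>s\<bar> \<le> 5/2 * r" using r rr zero_le_square[of r] unfolding s_def power2_eq_square by linarith
  then have "\<bar>s\<bar>^3 \<le> (5/2 * r)^3" by (intro power_mono) auto
  moreover have "s^3 \<le> \<bar>s\<bar>^3" by (metis abs_ge_self power_abs)
  ultimately have "s^3 \<le> (5/2 * r)^3" by linarith
  then have "5/16 * s^3 \<le> 625/128 * r^3" by (simp add: power_mult_distrib power3_eq_cube)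
  moreover have "r^3 \<ge> 0" using r by simp
  ultimately have s3: "5/16 * s^3 \<le> 5 * r^3" by linarith
  have "s\<^sup>2 = 4 * (Re q)\<^sup>2 + 4 * Re q * r\<^sup>2 + (r\<^sup>2)\<^sup>2"
    by (simp add: s_def power2_eq_square algebra_simps)
  moreover have "- r * r\<^sup>2 \<le> Re q * r\<^sup>2" using r by (intro mult_right_mono) auto
  moreover have "(r\<^sup>2)\<^sup>2 \<ge> 0" by simp
  moreover have "- r * r\<^sup>2 = - (r^3)" by (simp add: power2_eq_square power3_eq_cube)
  ultimately have s2: "s\<^sup>2 \<ge> 4 * (Re q)\<^sup>2 - 4 * r^3" by linarith
  have "Re (q\<^sup>2) = 2 * (Re q)\<^sup>2 - r\<^sup>2" unfolding r2 by (simp add: power2_eq_square)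
  moreover have "r^3 \<ge> 0" using r by simp
  ultimately have "1 - Re q + 3/4 * Re (q\<^sup>2) + r\<^sup>2 / 4 - 7 * r ^ 3 \<le> 1 - s/2 + 3/8 * s\<^sup>2 - 5/16 * s^3"
    using s2 s3 s_def by linarith
  with main show ?thesis by (simp add: t_def r_def)
qed

text \<open>The two sides can differ only by a multiple of \<open>2 * pi\<close>. Both arguments lie
  in [0, pi) and the increment lies strictly between -pi/2 and pi/2, so this multiple is 0.\<close>

lemma Arg_add_upper_half:
  assumes "Im z \<ge> 0" "Im (z + d) \<ge> 0" "z \<noteq> 0" "cmod (d / z) < 1"
    and "Arg z < pi" "Arg (z + d) < pi"
  shows "Arg (z + d) = Arg z + Im (Ln (1 + d / z))"
proof -
  have "Re (d / z) > -1" using assms(4) abs_Re_le_cmod[of "d/z"] by linarith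
  then have re: "Re (1 + d / z) > 0" by simp
  then have nz: "1 + d / z \<noteq> 0" by (metis less_irrefl zero_complex.sel(1))
  have e: "z + d = z * (1 + d / z)" using assms(3) by (simp add: field_simps)
  have b: "\<bar>Im (Ln (1 + d/z))\<bar> < pi/2" using Re_Ln_pos_lt[OF nz] re by simp
  have "0 \<le> Arg (z + d)" "0 \<le> Arg z" using assms by (auto simp: Arg_less_0)
  have nz2: "z + d \<noteq> 0" using e nz assms(3) by (metis mult_eq_0_iff)
  have "Ln (z + d) = (if Im(Ln z + Ln(1 + d/z)) \<le> -pi then (Ln z + Ln(1 + d/z)) + \<i> * of_real(2*pi)
             else if Im(Ln z + Ln(1 + d/z)) > pi then (Ln z + Ln(1 + d/z)) - \<i> * of_real(2*pi)
             else Ln z + Ln(1 + d/z))"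
    unfolding e using Ln_times[OF assms(3) nz] by simp
  then show ?thesis using b \<open>0 \<le> Arg z\<close> \<open>0 \<le> Arg (z+d)\<close> assms(3,5,6) nz2
    by (auto simp: Arg_eq_Im_Ln split: if_splits)
qed

section \<open>Centred walks in isotropic coordinates\<close>

definition jump_mean :: "(int \<Rightarrow> int \<Rightarrow> real) \<Rightarrow> (int \<Rightarrow> int \<Rightarrow> real) \<Rightarrow> real" where
  "jump_mean p f = (\<Sum>k\<in>{-1,0,1}. \<Sum>l\<in>{-1,0,1}. p k l * f k l)"

lemma jump_mean_add: "jump_mean p (\<lambda>k l. f k l + g k l) = jump_mean p f + jump_mean p g"
  by (simp add: jump_mean_def sum.distrib distrib_left)

lemma jump_mean_diff: "jump_mean p (\<lambda>k l. f k l - g k l) = jump_mean p f - jump_mean p g"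
  by (simp add: jump_mean_def sum_subtractf right_diff_distrib)

lemma jump_mean_cmult: "jump_mean p (\<lambda>k l. c * f k l) = c * jump_mean p f"
  by (simp add: jump_mean_def sum_distrib_left algebra_simps)

lemma jump_mean_cong:
  "(\<And>k l. k \<in> {-1,0,1} \<Longrightarrow> l \<in> {-1,0,1} \<Longrightarrow> f k l = g k l) \<Longrightarrow> jump_mean p f = jump_mean p g"
  by (simp add: jump_mean_def)

text \<open>The assumption \<open>isotropic\<close> says that the mean of
  \<open>(k + \<beta> * l)\<^sup>2\<close> vanishes: as a planar vector, the jump
  \<open>k + \<beta> * l\<close> has a covariance matrix that is a multiple of the identity.
  \<open>right_jump\<close> is the source of positive variance and of the strict decrease of the
  Lyapunov function.\<close>

locale centred_walk =
  fixes p :: "int \<Rightarrow> int \<Rightarrow> real" and \<beta> :: complex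
  assumes nonneg: "\<And>k l. k \<in> {-1,0,1} \<Longrightarrow> l \<in> {-1,0,1} \<Longrightarrow> p k l \<ge> 0"
    and total: "jump_mean p (\<lambda>k l. 1) = 1"
    and drift_x: "jump_mean p (\<lambda>k l. of_int k) = 0"
    and drift_y: "jump_mean p (\<lambda>k l. of_int l) = 0"
    and right_jump: "p 1 1 + p 1 0 + p 1 (-1) > 0"
    and isotropic: "of_real (jump_mean p (\<lambda>k l. (of_int k)\<^sup>2))
        + 2 * \<beta> * of_real (jump_mean p (\<lambda>k l. of_int k * of_int l))
        + \<beta>\<^sup>2 * of_real (jump_mean p (\<lambda>k l. (of_int l)\<^sup>2)) = 0"
    and Im_pos: "Im \<beta> > 0"
begin

abbreviation E where "E \<equiv> jump_mean p"

definition pos :: "int \<Rightarrow> int \<Rightarrow> complex" where "pos k l = of_int k + \<beta> * of_int l"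

definition M :: real where "M = 1 + cmod \<beta>"

definition var :: real where "var = E (\<lambda>k l. (cmod (pos k l))\<^sup>2)"

lemma E_const: "E (\<lambda>k l. c) = c"
  using jump_mean_cmult[of p c "\<lambda>_ _. 1"] total by simp

lemma E_mono:
  "(\<And>k l. k \<in> {-1,0,1} \<Longrightarrow> l \<in> {-1,0,1} \<Longrightarrow> f k l \<le> g k l) \<Longrightarrow> E f \<le> E g"
  unfolding jump_mean_def by (intro sum_mono mult_left_mono nonneg) auto

lemma M_ge_1: "M \<ge> 1"
  by (simp add: M_def)

lemma norm_pos_le:
  assumes "k \<in> {-1,0,1}" "l \<in> {-1,0,1}" shows "cmod (pos k l) \<le> M"
proof -
  have "cmod (pos k l) \<le> cmod (of_int k) + cmod (\<beta> * of_int l)"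
    unfolding pos_def by (rule norm_triangle_ineq)
  also have "\<dots> \<le> M" using assms by (auto simp: M_def norm_mult)
  finally show ?thesis .
qed

lemma pos_add: "pos (i + k) (j + l) = pos i j + pos k l"
  by (simp add: pos_def algebra_simps)

lemma E_linear: "E (\<lambda>k l. Re (c * pos k l)) = 0"
proof -
  have "E (\<lambda>k l. Re (c * pos k l)) = E (\<lambda>k l. Re c * of_int k + Re (c * \<beta>) * of_int l)"
    by (rule jump_mean_cong) (simp add: pos_def algebra_simps)
  then show ?thesis by (simp add: jump_mean_add jump_mean_cmult drift_x drift_y)
qed

text \<open>After expanding the square, this is the real part of \<open>c\<close> times the equation
  \<open>isotropic\<close>.\<close>

lemma E_square: "E (\<lambda>k l. Re (c * (pos k l)\<^sup>2)) = 0"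
proof -
  let ?a = "E (\<lambda>k l. (of_int k)\<^sup>2)" and ?b = "E (\<lambda>k l. of_int k * of_int l)"
    and ?c = "E (\<lambda>k l. (of_int l)\<^sup>2)"
  have "E (\<lambda>k l. Re (c * (pos k l)\<^sup>2))
      = E (\<lambda>k l. Re c * (of_int k)\<^sup>2 + Re (2 * c * \<beta>) * (of_int k * of_int l)
            + Re (c * \<beta>\<^sup>2) * (of_int l)\<^sup>2)"
    by (rule jump_mean_cong) (simp add: pos_def power2_eq_square algebra_simps)
  also have "\<dots> = Re c * ?a + Re (2 * c * \<beta>) * ?b + Re (c * \<beta>\<^sup>2) * ?c"
    by (simp only: jump_mean_add jump_mean_cmult)
  also have "\<dots> = Re (c * (of_real ?a + 2 * \<beta> * of_real ?b + \<beta>\<^sup>2 * of_real ?c))"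
    by (simp add: algebra_simps)
  also have "\<dots> = 0" by (simp only: isotropic) simp
  finally show ?thesis .
qed

text \<open>Common shape of all expansions below. The holomorphic linear and quadratic terms average
  out; only the squared modulus survives, which is how the Laplacian of the expanded function
  appears.\<close>

lemma E_second_order:
  "E (\<lambda>k l. a + Re (b * pos k l) + Re (c * (pos k l)\<^sup>2) + d * (cmod (pos k l))\<^sup>2) = a + d * var"
  by (simp only: jump_mean_add jump_mean_cmult E_const E_linear E_square var_def)

lemma var_pos: "var > 0"
proof -
  have 1: "(cmod (pos 1 l))\<^sup>2 \<ge> min ((cmod (pos 1 1))\<^sup>2) (min ((cmod (pos 1 0))\<^sup>2) ((cmod (pos 1 (-1)))\<^sup>2))"
    (is "_ \<ge> ?m") if "l \<in> {-1,0,1}" for l using that by auto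
  have "pos 1 1 \<noteq> 0" "pos 1 0 \<noteq> 0" "pos 1 (-1) \<noteq> 0"
    using Im_pos by (auto simp: pos_def complex_eq_iff)
  then have m: "?m > 0" by simp
  have "0 < ?m * (p 1 1 + p 1 0 + p 1 (-1))" using m right_jump by (rule mult_pos_pos)
  also have "\<dots> = E (\<lambda>k l. if k = 1 then ?m else 0)"
    by (simp add: jump_mean_def algebra_simps)
  also have "\<dots> \<le> var" unfolding var_def using 1 by (intro E_mono) auto
  finally show ?thesis .
qed

lemma quadrant:
  assumes "i \<ge> 0" "j \<ge> 0" "pos i j \<noteq> 0"
  shows "Im (pos i j) \<ge> 0" "Arg (pos i j) < pi" "Arg (pos i j) \<ge> 0"
proof -
  show im: "Im (pos i j) \<ge> 0" using assms Im_pos by (simp add: pos_def)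
  then show "Arg (pos i j) \<ge> 0" by (simp add: Arg_less_0)
  have "\<not> (Re (pos i j) < 0 \<and> Im (pos i j) = 0)"
    using assms Im_pos by (auto simp: pos_def)
  then show "Arg (pos i j) < pi" using Arg_le_pi Arg_eq_pi by (metis less_eq_real_def)
qed

section \<open>Mean change of the argument and of the barrier over one jump\<close>

text \<open>The threshold \<open>2 * M\<close> makes the relative jump at most 1/2, the range in
  which the expansions hold, and keeps the walk from reaching the origin in one jump.\<close>

lemma relative_jump:
  assumes "cmod (pos i j) \<ge> 2 * M" "k \<in> {-1,0,1}" "l \<in> {-1,0,1}"
  shows "pos i j \<noteq> 0" "pos (i + k) (j + l) \<noteq> 0"
    "cmod (pos k l / pos i j) \<le> 1/2" "cmod (pos k l / pos i j) ^ 3 \<le> M ^ 3 / cmod (pos i j) ^ 3"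
proof -
  show nz: "pos i j \<noteq> 0" using assms(1) M_ge_1 by auto
  have le: "cmod (pos k l) \<le> M" using assms by (intro norm_pos_le)
  then show "cmod (pos k l / pos i j) \<le> 1/2"
    using assms(1) nz by (simp add: norm_divide field_simps)
  show "cmod (pos k l / pos i j) ^ 3 \<le> M ^ 3 / cmod (pos i j) ^ 3"
    using le by (auto simp: norm_divide power_divide intro!: divide_right_mono power_mono)
  show "pos (i + k) (j + l) \<noteq> 0"
    using assms(1) le M_ge_1 norm_diff_ineq[of "pos i j" "pos k l"] unfolding pos_add by auto
qed

text \<open>The increment of \<open>Arg\<close> is the imaginary part of \<open>Ln (1 + q)\<close>.
  Its terms of order one and two are real parts of holomorphic terms and have mean 0, so only the
  cubic remainder is left.\<close>

lemma E_Arg: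
  assumes "i \<ge> 1" "j \<ge> 1" and large: "cmod (pos i j) \<ge> 2 * M"
  shows "\<bar>E (\<lambda>k l. Arg (pos (i + k) (j + l))) - Arg (pos i j)\<bar> \<le> 8 * M ^ 3 / cmod (pos i j) ^ 3"
proof -
  define z where "z = pos i j"
  define e where "e = 8 * M ^ 3 / cmod z ^ 3"
  \<comment> \<open>The factor \<open>- \<i>\<close> turns imaginary parts into real parts, and the
    coefficient 0 of the squared modulus reflects that \<open>Arg\<close> is harmonic.\<close>
  define g where "g = (\<lambda>k l. Arg z + Re ((- \<i> / z) * pos k l) + Re ((\<i> / (2 * z\<^sup>2)) * (pos k l)\<^sup>2)
      + 0 * (cmod (pos k l))\<^sup>2)"
  have *: "\<bar>Arg (pos (i + k) (j + l)) - g k l\<bar> \<le> e" if kl: "k \<in> {-1,0,1}" "l \<in> {-1,0,1}" for k l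
  proof -
    define q where "q = pos k l / z"
    note rel = relative_jump[OF large kl, folded z_def, folded q_def]
    have "Arg (z + pos k l) = Arg z + Im (Ln (1 + q))"
      unfolding q_def
    proof (rule Arg_add_upper_half)
      have "i + k \<ge> 0" "j + l \<ge> 0" using assms kl by auto
      then show "0 \<le> Im (z + pos k l)" "Arg (z + pos k l) < pi"
        using quadrant[of "i + k" "j + l"] rel(2) by (auto simp: pos_add z_def)
      show "0 \<le> Im z" "Arg z < pi" using quadrant[of i j] rel(1) assms by (auto simp: z_def)
      show "cmod (pos k l / z) < 1" using rel(3) by (simp add: q_def)
    qed (rule rel(1))
    moreover have "g k l = Arg z + Im q - Im (q\<^sup>2 / 2)"
    proof -
      have "(- \<i> / z) * pos k l = - \<i> * q" "(\<i> / (2 * z\<^sup>2)) * (pos k l)\<^sup>2 = \<i> * (q\<^sup>2 / 2)"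
        by (simp_all add: q_def power_divide)
      then show ?thesis unfolding g_def by (simp only:) simp
    qed
    ultimately have "\<bar>Arg (pos (i + k) (j + l)) - g k l\<bar> = \<bar>Im (Ln (1 + q) - q + q\<^sup>2 / 2)\<bar>"
      unfolding pos_add z_def[symmetric] by simp
    also have "\<dots> \<le> 8 * cmod q ^ 3"
      using abs_Im_le_cmod Ln_one_plus_approx[OF rel(3)] by (rule order_trans)
    also have "\<dots> \<le> e" using rel(4) by (simp add: e_def)
    finally show ?thesis .
  qed
  have Eg: "E g = Arg z" unfolding g_def E_second_order by simp
  have "E (\<lambda>k l. Arg (pos (i + k) (j + l))) \<le> E (\<lambda>k l. g k l + e)"
    using * by (intro E_mono) (smt (verit))
  moreover have "E (\<lambda>k l. g k l - e) \<le> E (\<lambda>k l. Arg (pos (i + k) (j + l)))"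
    using * by (intro E_mono) (smt (verit))
  ultimately show ?thesis
    by (simp add: jump_mean_add jump_mean_diff E_const Eg z_def[symmetric] e_def[symmetric])
qed

text \<open>The constant \<open>a\<close> is chosen so that \<open>(a sin \<theta> - (1 - cos \<theta>)) \<ge> j / |z|\<close>, using \<open>|z| - Re z \<le> 2 |\<beta>| j\<close>
  and \<open>Im z = j Im \<beta>\<close>.\<close>

definition c :: complex where "c = Complex 1 ((2 * cmod \<beta> + 1) / Im \<beta>)"

text \<open>Since \<open>c = 1 + \<i> * a\<close>, the real part of \<open>c / z\<close> equals
  \<open>(cos \<theta> + a * sin \<theta>) / |z|\<close>, which is harmonic, while
  \<open>- 1 / |z|\<close> is strictly superharmonic.\<close>

definition barrier :: "int \<Rightarrow> int \<Rightarrow> real" where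
  "barrier i j = Re (c / pos i j) - 1 / cmod (pos i j)"

text \<open>The harmonic part contributes only to the remainder; \<open>- 1 / |z|\<close>
  contributes the decrease of order 3 in \<open>1 / |z|\<close>, which beats the remainder of order
  4 far from the origin.\<close>

lemma E_barrier:
  assumes large: "cmod (pos i j) \<ge> 2 * M"
  shows "E (\<lambda>k l. barrier (i + k) (j + l))
    \<le> barrier i j - var / (4 * cmod (pos i j) ^ 3) + (2 * cmod c + 7) * M ^ 3 / cmod (pos i j) ^ 4"
proof -
  define z where "z = pos i j"
  define e where "e = (2 * cmod c + 7) * M ^ 3 / cmod z ^ 4"
  define r where "r = cmod z"
  have z: "z \<noteq> 0" using large M_ge_1 by (auto simp: z_def)
  have r: "r > 0" using z by (simp add: r_def)
  \<comment> \<open>\<open>b1\<close> and \<open>b2\<close> collect the coefficients of the jump and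
    of its square from the expansions of \<open>c / (z * (1 + q))\<close> and
    \<open>1 / (r * cmod (1 + q))\<close>.\<close>
  define b1 where "b1 = - c / z\<^sup>2 + 1 / (of_real r * z)"
  define b2 where "b2 = c / z^3 - 3 / (4 * of_real r * z\<^sup>2)"
  define g where "g = (\<lambda>k l. (barrier i j + e) + Re (b1 * pos k l) + Re (b2 * (pos k l)\<^sup>2)
      + (- 1 / (4 * r^3)) * (cmod (pos k l))\<^sup>2)"
  have "barrier (i + k) (j + l) \<le> g k l" if kl: "k \<in> {-1,0,1}" "l \<in> {-1,0,1}" for k l
  proof -
    define q where "q = pos k l / z"
    note rel = relative_jump[OF large kl, folded z_def, folded q_def]
    have d: "pos k l = q * z" using z by (simp add: q_def)
    have sum: "pos (i + k) (j + l) = z * (1 + q)"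
      unfolding pos_add z_def[symmetric] d by (simp add: algebra_simps)
    have "Re (c / pos (i + k) (j + l)) - Re (c / z * (1 - q + q\<^sup>2))
        = Re (c / z * (1 / (1 + q) - (1 - q + q\<^sup>2)))"
      by (simp add: sum right_diff_distrib)
    also have "\<dots> \<le> cmod (c / z * (1 / (1 + q) - (1 - q + q\<^sup>2)))"
      by (rule complex_Re_le_cmod)
    also have "\<dots> = cmod c / r * cmod (1 / (1 + q) - (1 - q + q\<^sup>2))"
      by (simp add: norm_mult norm_divide r_def)
    also have "\<dots> \<le> cmod c / r * (2 * cmod q ^ 3)"
      using r by (intro mult_left_mono inverse_one_plus_approx rel) auto
    finally have h1: "Re (c / pos (i + k) (j + l)) \<le> Re (c / z * (1 - q + q\<^sup>2)) + cmod c / r * (2 * cmod q ^ 3)"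
      by simp
    have "1 / r * (1 - Re q + 3/4 * Re (q\<^sup>2) + (cmod q)\<^sup>2 / 4 - 7 * cmod q ^ 3) \<le> 1 / r * (1 / cmod (1 + q))"
      using r by (intro mult_left_mono inverse_cmod_one_plus_lower rel) auto
    also have "\<dots> = 1 / cmod (pos (i + k) (j + l))"
      by (simp add: sum norm_mult r_def)
    finally have h2: "1 / cmod (pos (i + k) (j + l))
      \<ge> 1 / r * (1 - Re q + 3/4 * Re (q\<^sup>2) + (cmod q)\<^sup>2 / 4 - 7 * cmod q ^ 3)" .
    have "(2 * cmod c + 7) / r * cmod q ^ 3 \<le> (2 * cmod c + 7) / r * (M ^ 3 / r ^ 3)"
      using rel(4) r by (intro mult_left_mono) (auto simp: r_def)
    also have "\<dots> = e" using r by (simp add: e_def r_def power4_eq_xxxx power3_eq_cube)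
    finally have h3: "(2 * cmod c + 7) / r * cmod q ^ 3 \<le> e" .
    have "b1 * pos k l = - (c / z * q) + q / of_real r"
      using z r by (simp add: b1_def d field_simps power2_eq_square)
    then have g1: "Re (b1 * pos k l) = - Re (c / z * q) + Re q / r"
      by simp
    have "b2 * (pos k l)\<^sup>2 = c / z * q\<^sup>2 - (3/4 * q\<^sup>2) / of_real r"
      using z r by (simp add: b2_def d field_simps power2_eq_square power3_eq_cube)
    then have g2: "Re (b2 * (pos k l)\<^sup>2) = Re (c / z * q\<^sup>2) - (3/4 * Re (q\<^sup>2)) / r"
      by simp
    have g3: "- 1 / (4 * r^3) * (cmod (pos k l))\<^sup>2 = - (cmod q)\<^sup>2 / (4 * r)"
      using r by (simp add: d norm_mult r_def[symmetric] power2_eq_square power3_eq_cube)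
    have g0: "barrier i j = Re (c / z) - 1 / r" by (simp add: barrier_def z_def r_def)
    have "c / z * (1 - q + q\<^sup>2) = c / z - c / z * q + c / z * q\<^sup>2" by (simp add: algebra_simps)
    then have "Re (c / z * (1 - q + q\<^sup>2)) = Re (c / z) - Re (c / z * q) + Re (c / z * q\<^sup>2)"
      by simp
    then have "g k l = Re (c / z * (1 - q + q\<^sup>2))
        - 1 / r * (1 - Re q + 3/4 * Re (q\<^sup>2) + (cmod q)\<^sup>2 / 4) + e"
      unfolding g_def g0 g1 g2 g3 by (simp add: algebra_simps add_divide_distrib diff_divide_distrib)
    moreover have "barrier (i + k) (j + l) \<le> Re (c / z * (1 - q + q\<^sup>2)) + cmod c / r * (2 * cmod q ^ 3)
        - 1 / r * (1 - Re q + 3/4 * Re (q\<^sup>2) + (cmod q)\<^sup>2 / 4 - 7 * cmod q ^ 3)"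
      using h1 h2 unfolding barrier_def by linarith
    moreover have "\<dots> = Re (c / z * (1 - q + q\<^sup>2)) - 1 / r * (1 - Re q + 3/4 * Re (q\<^sup>2) + (cmod q)\<^sup>2 / 4)
        + (2 * cmod c + 7) / r * cmod q ^ 3"
      using r by (simp add: field_simps)
    ultimately show ?thesis using h3 by linarith
  qed
  then have "E (\<lambda>k l. barrier (i + k) (j + l)) \<le> E g" by (rule E_mono)
  also have "E g = barrier i j + e + (- 1 / (4 * r^3)) * var" unfolding g_def by (rule E_second_order)
  finally show ?thesis by (simp add: e_def r_def z_def)
qed

text \<open>The barrier equals
  \<open>((2 * cmod \<beta> + 1) * j - (|z| - Re z)) / |z|\<^sup>2\<close>, and
  \<open>|z| - Re z\<close> lies between 0 and \<open>2 * cmod \<beta> * j\<close>.\<close>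

lemma barrier_bounds:
  assumes "i \<ge> 0" "j \<ge> 0" "pos i j \<noteq> 0"
  shows "of_int j / (cmod (pos i j))\<^sup>2 \<le> barrier i j"
    and "barrier i j \<le> (2 * cmod \<beta> + 1) * of_int j / (cmod (pos i j))\<^sup>2"
proof -
  define z where "z = pos i j"
  define r where "r = cmod z"
  have r: "r > 0" using assms by (simp add: r_def z_def)
  have r2: "r\<^sup>2 = (Re z)\<^sup>2 + (Im z)\<^sup>2" unfolding r_def by (rule cmod_power2)
  have "Re (c / z) = (Re z + (2 * cmod \<beta> + 1) / Im \<beta> * Im z) / r\<^sup>2"
    unfolding Re_divide r2 by (simp add: c_def)
  also have "(2 * cmod \<beta> + 1) / Im \<beta> * Im z = (2 * cmod \<beta> + 1) * of_int j"
    using Im_pos by (simp add: z_def pos_def)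
  finally have eq: "barrier i j = ((2 * cmod \<beta> + 1) * of_int j - (r - Re z)) / r\<^sup>2"
    using r by (simp add: barrier_def z_def[symmetric] r_def[symmetric] field_simps power2_eq_square)
  have "r - Re z \<ge> 0" using complex_Re_le_cmod[of z] by (simp add: r_def)
  then show "barrier i j \<le> (2 * cmod \<beta> + 1) * of_int j / (cmod (pos i j))\<^sup>2"
    unfolding eq z_def[symmetric] r_def[symmetric] by (intro divide_right_mono) auto
  have "r \<le> of_int i + cmod \<beta> * of_int j"
    unfolding r_def z_def pos_def
    using norm_triangle_ineq[of "of_int i" "\<beta> * of_int j"] assms by (simp add: norm_mult)
  moreover have "Re z = of_int i + Re \<beta> * of_int j" by (simp add: z_def pos_def)
  moreover have "- cmod \<beta> * of_int j \<le> Re \<beta> * of_int j"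
    using assms abs_Re_le_cmod[of \<beta>] by (intro mult_right_mono) auto
  ultimately have "r - Re z \<le> 2 * cmod \<beta> * of_int j" by linarith
  then show "of_int j / (cmod (pos i j))\<^sup>2 \<le> barrier i j"
    unfolding eq z_def[symmetric] r_def[symmetric]
    by (intro divide_right_mono) (auto simp: algebra_simps)
qed

section \<open>Comparison with the angle function\<close>

text \<open>Opening angle of the cone onto which the linear map \<open>pos\<close> sends the
  quadrant.\<close>

definition \<Theta> :: real where "\<Theta> = Arg \<beta>"

lemma \<Theta>_bounds: "0 < \<Theta>" "\<Theta> < pi"
  using Arg_lt_pi[of \<beta>] Im_pos by (auto simp: \<Theta>_def)

definition angle :: "int \<Rightarrow> int \<Rightarrow> real" where "angle i j = Arg (pos i j) / \<Theta>"

lemma pos_eq_0_iff: "pos i j = 0 \<longleftrightarrow> i = 0 \<and> j = 0"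
  using Im_pos by (auto simp: pos_def complex_eq_iff)

lemma barrier_nonneg:
  assumes "i \<ge> 0" "j \<ge> 0" "pos i j \<noteq> 0" shows "barrier i j \<ge> 0"
  using barrier_bounds(1)[OF assms] assms
  by (meson divide_nonneg_nonneg of_int_0_le_iff order_trans zero_le_power2)

lemma angle_bounds:
  assumes "i \<ge> 0" "j \<ge> 0" "pos i j \<noteq> 0" shows "angle i j \<ge> 0" "angle i j \<le> pi / \<Theta>"
  using quadrant[OF assms] \<Theta>_bounds by (auto simp: angle_def intro!: divide_right_mono)

lemma angle_vertical: "j \<ge> 1 \<Longrightarrow> angle 0 j = 1"
  using \<Theta>_bounds Arg_times_of_real2[of "of_int j" \<beta>] by (simp add: angle_def pos_def \<Theta>_def)

lemma angle_horizontal: "i \<ge> 1 \<Longrightarrow> angle i 0 = 0"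
  using Arg_of_real[of "of_int i"] by (simp add: angle_def pos_def del: Arg_of_real)

text \<open>First \<open>R\<close> is taken so large that the decrease of the barrier dominates its
  own error beyond \<open>R\<close>. Then \<open>K\<close> is taken so large that what remains
  dominates the error of the angle and that, inside radius \<open>R\<close>, the scaled barrier
  exceeds \<open>pi / \<Theta>\<close>, a bound for the angle that is itself at least 1.\<close>

lemma comparison_constants:
  obtains K R where "K > 0" "R \<ge> 2 * M"
    "\<And>i j. i \<ge> 1 \<Longrightarrow> j \<ge> 1 \<Longrightarrow> cmod (pos i j) \<ge> R \<Longrightarrow>
        \<bar>E (\<lambda>k l. angle (i + k) (j + l)) - angle i j\<bar>
          \<le> K * (barrier i j - E (\<lambda>k l. barrier (i + k) (j + l)))"
    "\<And>i j. i \<ge> 1 \<Longrightarrow> j \<ge> 1 \<Longrightarrow> cmod (pos i j) < R \<Longrightarrow> K * barrier i j \<ge> pi / \<Theta>"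
proof
  define D where "D = (2 * cmod c + 7) * M ^ 3"
  define D' where "D' = 8 * M ^ 3 / \<Theta>"
  define R where "R = max (2 * M) (8 * D / var)"
  define K where "K = max (pi / \<Theta> * R\<^sup>2) (8 * D' / var)"
  show RM: "R \<ge> 2 * M" by (simp add: R_def)
  then have Rpos: "R > 0" using M_ge_1 by linarith
  then have "pi / \<Theta> * R\<^sup>2 > 0" using \<Theta>_bounds by (intro mult_pos_pos divide_pos_pos) auto
  then show K: "K > 0" by (simp add: K_def)
  show "\<bar>E (\<lambda>k l. angle (i + k) (j + l)) - angle i j\<bar>
      \<le> K * (barrier i j - E (\<lambda>k l. barrier (i + k) (j + l)))"
    if ij: "i \<ge> 1" "j \<ge> 1" and far: "cmod (pos i j) \<ge> R" for i j
  proof -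
    define r where "r = cmod (pos i j)"
    have r: "r \<ge> R" "r \<ge> 2 * M" "r > 0" using far RM Rpos by (auto simp: r_def)
    have "E (\<lambda>k l. angle (i + k) (j + l)) = E (\<lambda>k l. Arg (pos (i + k) (j + l))) / \<Theta>"
      using jump_mean_cmult[of p "1 / \<Theta>" "\<lambda>k l. Arg (pos (i + k) (j + l))"] by (simp add: angle_def)
    then have "\<bar>E (\<lambda>k l. angle (i + k) (j + l)) - angle i j\<bar>
        = \<bar>E (\<lambda>k l. Arg (pos (i + k) (j + l))) - Arg (pos i j)\<bar> / \<Theta>"
      using \<Theta>_bounds by (simp add: angle_def flip: diff_divide_distrib)
    also have "\<dots> \<le> (8 * M ^ 3 / r ^ 3) / \<Theta>"
      using E_Arg[OF ij] r \<Theta>_bounds by (intro divide_right_mono) (auto simp: r_def)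
    also have "\<dots> = D' / r ^ 3" by (simp add: D'_def)
    also have "\<dots> \<le> K * (var / (8 * r ^ 3))"
    proof -
      have "8 * D' / var \<le> K" by (simp add: K_def)
      then show ?thesis using var_pos r by (simp add: field_simps)
    qed
    also have "\<dots> \<le> K * (barrier i j - E (\<lambda>k l. barrier (i + k) (j + l)))"
    proof -
      \<comment> \<open>Half of the decrease \<open>var / (4 * r ^ 3)\<close> pays for the error of
        order 4; the other half is left for the angle.\<close>
      have "8 * D / var \<le> r" using r by (simp add: R_def)
      then have "D / r ^ 4 \<le> var / (8 * r ^ 3)"
        using var_pos r by (simp add: field_simps power4_eq_xxxx power3_eq_cube)
      moreover have "E (\<lambda>k l. barrier (i + k) (j + l)) \<le> barrier i j - var / (4 * r ^ 3) + D / r ^ 4"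
        using E_barrier[of i j] r by (simp add: r_def D_def)
      moreover have "var / (4 * r ^ 3) = 2 * (var / (8 * r ^ 3))" by simp
      ultimately show ?thesis using K by (intro mult_left_mono) linarith+
    qed
    finally show ?thesis .
  qed
  show "K * barrier i j \<ge> pi / \<Theta>" if ij: "i \<ge> 1" "j \<ge> 1" and near: "cmod (pos i j) < R" for i j
  proof -
    have nz: "pos i j \<noteq> 0" using ij by (simp add: pos_eq_0_iff)
    have "(cmod (pos i j))\<^sup>2 \<le> R\<^sup>2" using near by (intro power_mono) auto
    then have "1 / R\<^sup>2 \<le> of_int j / (cmod (pos i j))\<^sup>2"
      using ij nz Rpos by (intro frac_le) auto
    also have "\<dots> \<le> barrier i j" using ij nz by (intro barrier_bounds) auto
    finally have b: "1 / R\<^sup>2 \<le> barrier i j" .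
    have "pi / \<Theta> = pi / \<Theta> * R\<^sup>2 * (1 / R\<^sup>2)" using Rpos by simp
    also have "\<dots> \<le> K * (1 / R\<^sup>2)" by (intro mult_right_mono) (auto simp: K_def)
    also have "\<dots> \<le> K * barrier i j" using b K by (intro mult_left_mono) auto
    finally show ?thesis .
  qed
qed

section \<open>The hitting probability as a monotone limit\<close>

lemma hit_Suc:
  "i \<noteq> 0 \<Longrightarrow> j \<noteq> 0 \<Longrightarrow> hit_V_within p (Suc n) i j = E (\<lambda>k l. hit_V_within p n (i + k) (j + l))"
  unfolding jump_mean_def hit_V_within.simps(2) by simp

lemma hit_bounds: "0 \<le> hit_V_within p n i j" "hit_V_within p n i j \<le> 1"
proof -
  have "0 \<le> hit_V_within p n i j \<and> hit_V_within p n i j \<le> 1"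
  proof (induction n arbitrary: i j)
    case (Suc n)
    show ?case
    proof (cases "i = 0 \<or> j = 0")
      case False
      have "0 \<le> E (\<lambda>k l. hit_V_within p n (i + k) (j + l))"
        "E (\<lambda>k l. hit_V_within p n (i + k) (j + l)) \<le> 1"
        using E_mono[of "\<lambda>_ _. 0"] E_mono[of _ "\<lambda>_ _. 1"] Suc by (simp_all add: E_const)
      then show ?thesis using hit_Suc[of i j n] False by simp
    qed auto
  qed auto
  then show "0 \<le> hit_V_within p n i j" "hit_V_within p n i j \<le> 1" by auto
qed

lemma hit_mono: "hit_V_within p n i j \<le> hit_V_within p (Suc n) i j"
proof (induction n arbitrary: i j)
  case 0
  then show ?case
    using hit_bounds(1)[of "Suc 0" i j] by (cases "i = 0") (simp, simp del: hit_V_within.simps(2))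
next
  case (Suc n)
  show ?case
  proof (cases "i = 0 \<or> j = 0")
    case False
    then have "i \<noteq> 0" "j \<noteq> 0" by auto
    then show ?thesis unfolding hit_Suc[OF \<open>i \<noteq> 0\<close> \<open>j \<noteq> 0\<close>] using Suc by (intro E_mono)
  qed auto
qed

abbreviation h where "h \<equiv> hit_V_before_H p"

lemma hit_tendsto: "(\<lambda>n. hit_V_within p n i j) \<longlonglongrightarrow> h i j"
  unfolding hit_V_before_H_def
  by (rule LIMSEQ_incseq_SUP)
     (auto intro!: bdd_aboveI2[where M = 1] hit_bounds(2) incseq_SucI hit_mono)

lemma h_bounds: "0 \<le> h i j"
  by (rule LIMSEQ_le_const[OF hit_tendsto]) (auto intro: hit_bounds)

lemma h_vertical: "h 0 j = 1"
proof -
  have "hit_V_within p n 0 j = 1" for n by (cases n) auto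
  then show ?thesis by (simp add: hit_V_before_H_def)
qed

text \<open>Limit of the one-step recursion; the mean is a finite sum, so limits pass through
  it.\<close>

lemma h_harmonic:
  assumes "i \<noteq> 0" "j \<noteq> 0" shows "h i j = E (\<lambda>k l. h (i + k) (j + l))"
proof (rule LIMSEQ_unique)
  show "(\<lambda>n. hit_V_within p (Suc n) i j) \<longlonglongrightarrow> h i j"
    using hit_tendsto by (rule LIMSEQ_Suc)
  show "(\<lambda>n. hit_V_within p (Suc n) i j) \<longlonglongrightarrow> E (\<lambda>k l. h (i + k) (j + l))"
    unfolding hit_Suc[OF assms] jump_mean_def by (intro tendsto_intros hit_tendsto)
qed

section \<open>Maximum principle on the unbounded quadrant\<close>

text \<open>The square root is strictly concave and the walk has no drift; the linear term in
  \<open>j\<close> has no mean change and serves to make the function tend to infinity in every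
  direction of the quadrant.\<close>

lemma Lyapunov_decrease:
  assumes "i \<ge> 1"
  shows "E (\<lambda>k l. sqrt (of_int (i + k)) + of_int (j + l)) < sqrt (of_int i) + of_int j"
proof -
  let ?f = "\<lambda>k. sqrt (of_int (i + k))"
  define a where "a = p 1 1 + p 1 0 + p 1 (-1)"
  \<comment> \<open>Zero drift makes left and right jumps equally likely, so the mean change is
    \<open>a\<close> times a second difference.\<close>
  have "p (-1) 1 + p (-1) 0 + p (-1) (-1) = a"
    using drift_x by (simp add: jump_mean_def a_def)
  then have left: "p (-1) (-1) = a - p (-1) 1 - p (-1) 0" by simp
  have "E (\<lambda>k l. ?f k - ?f 0) = a * (?f 1 + ?f (-1) - 2 * ?f 0)"
    unfolding jump_mean_def by (simp add: left) (simp add: a_def algebra_simps)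
  moreover have "?f 1 + ?f (-1) < 2 * ?f 0"
  proof -
    have x: "(real_of_int i) \<ge> 1" using assms by simp
    have "sqrt (of_int i + 1) * sqrt (of_int i - 1) < of_int i"
      unfolding real_sqrt_mult[symmetric] using x
      by (intro real_less_lsqrt) (auto simp: power2_eq_square algebra_simps)
    then have "(?f 1 + ?f (-1))\<^sup>2 < (2 * ?f 0)\<^sup>2"
      using x by (simp add: power2_sum power_mult_distrib algebra_simps)
    then show ?thesis using x by (intro power2_less_imp_less[of _ "2 * ?f 0"]) auto
  qed
  then have "a * (?f 1 + ?f (-1) - 2 * ?f 0) < 0"
    using right_jump by (intro mult_pos_neg) (auto simp: a_def)
  ultimately have "E (\<lambda>k l. ?f k) < ?f 0" by (simp add: jump_mean_diff E_const)
  then show ?thesis by (simp add: jump_mean_add E_const drift_y)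
qed

text \<open>Subtracting a small multiple of the Lyapunov function leaves only finitely many points
  with a positive value. At a maximiser among them, which is interior, the strict Lyapunov decrease
  contradicts \<open>sub\<close>. Restricting \<open>sub\<close> to points with
  \<open>D i j > 0\<close> lets the application ignore a neighbourhood of the origin.\<close>

lemma maximum_principle:
  assumes sub: "\<And>i j. i \<ge> 1 \<Longrightarrow> j \<ge> 1 \<Longrightarrow> D i j > 0 \<Longrightarrow> D i j \<le> E (\<lambda>k l. D (i + k) (j + l))"
    and boundary: "\<And>i j. i \<ge> 0 \<Longrightarrow> j \<ge> 0 \<Longrightarrow> i = 0 \<or> j = 0 \<Longrightarrow> D i j \<le> 0"
    and bounded: "\<And>i j. i \<ge> 0 \<Longrightarrow> j \<ge> 0 \<Longrightarrow> D i j \<le> B"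
    and ij: "i \<ge> 0" "j \<ge> 0"
  shows "D i j \<le> 0"
proof (rule ccontr)
  define g where "g = (\<lambda>i j. sqrt (of_int i) + real_of_int j)"
  assume "\<not> D i j \<le> 0"
  have g_nonneg: "g i j \<ge> 0" if "i \<ge> 0" "j \<ge> 0" for i j using that by (simp add: g_def)
  \<comment> \<open>Small enough that the penalty at the given point is at most half of
    \<open>D i j\<close>.\<close>
  define \<epsilon> where "\<epsilon> = D i j / (2 * (g i j + 1))"
  have \<epsilon>: "\<epsilon> > 0" using \<open>\<not> D i j \<le> 0\<close> g_nonneg[OF ij] by (simp add: \<epsilon>_def)
  define F where "F = (\<lambda>i j. D i j - \<epsilon> * g i j)"
  define S where "S = {(i, j). i \<ge> 0 \<and> j \<ge> 0 \<and> F i j > 0}"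
  have "\<epsilon> * g i j < D i j"
  proof -
    have "\<epsilon> * g i j \<le> \<epsilon> * (g i j + 1)" using \<epsilon> by simp
    also have "\<dots> = D i j / 2" using g_nonneg[OF ij] by (simp add: \<epsilon>_def field_simps)
    also have "\<dots> < D i j" using \<open>\<not> D i j \<le> 0\<close> by simp
    finally show ?thesis .
  qed
  then have ne: "(i, j) \<in> S" using ij by (simp add: S_def F_def)
  have "S \<subseteq> {0..\<lceil>(B / \<epsilon>)\<^sup>2\<rceil>} \<times> {0..\<lceil>B / \<epsilon>\<rceil>}"
  proof clarify
    fix i j assume "(i, j) \<in> S"
    then have ij: "i \<ge> 0" "j \<ge> 0" and "F i j > 0" by (auto simp: S_def)
    then have "\<epsilon> * g i j < B" using bounded[OF ij] by (simp add: F_def)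
    then have gB: "g i j < B / \<epsilon>" using \<epsilon> by (simp add: field_simps)
    have "sqrt (of_int i) \<le> g i j" "of_int j \<le> g i j" using ij by (auto simp: g_def)
    then have "sqrt (of_int i) \<le> B / \<epsilon>" and j: "of_int j \<le> B / \<epsilon>" using gB by linarith+
    then have "(sqrt (of_int i))\<^sup>2 \<le> (B / \<epsilon>)\<^sup>2" using ij by (intro power_mono) auto
    then have "of_int i \<le> (B / \<epsilon>)\<^sup>2" using ij by simp
    then show "i \<in> {0..\<lceil>(B / \<epsilon>)\<^sup>2\<rceil>} \<and> j \<in> {0..\<lceil>B / \<epsilon>\<rceil>}"
      using ij j by (auto simp: le_ceiling_iff intro: less_le_trans)
  qed
  then have fin: "finite S" by (rule finite_subset) auto
  then obtain x where x: "x \<in> S" "\<And>y. y \<in> S \<Longrightarrow> case_prod F y \<le> case_prod F x"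
    using ne obtains_MAX[of S "case_prod F"] by (metis Max_ge empty_iff finite_imageI image_eqI)
  obtain a b where ab: "x = (a, b)" by (cases x)
  have Fab: "F a b > 0" "a \<ge> 0" "b \<ge> 0" using x(1) by (auto simp: ab S_def)
  then have Dab: "D a b > 0" using mult_nonneg_nonneg[of \<epsilon> "g a b"] g_nonneg[of a b] \<epsilon>
    unfolding F_def by linarith
  then have "a \<noteq> 0" "b \<noteq> 0" using boundary[of a b] Fab by auto
  then have ab1: "a \<ge> 1" "b \<ge> 1" using Fab by auto
  have "E (\<lambda>k l. F (a + k) (b + l)) \<le> E (\<lambda>k l. F a b)"
  proof (rule E_mono)
    fix k l :: int assume "k \<in> {-1,0,1}" "l \<in> {-1,0,1}"
    then have "a + k \<ge> 0" "b + l \<ge> 0" using ab1 by auto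
    then show "F (a + k) (b + l) \<le> F a b"
      using x(2)[of "(a + k, b + l)"] Fab
      by (cases "F (a + k) (b + l) > 0") (auto simp: ab S_def)
  qed
  then have "E (\<lambda>k l. D (a + k) (b + l)) - \<epsilon> * E (\<lambda>k l. g (a + k) (b + l)) \<le> D a b - \<epsilon> * g a b"
    by (simp add: F_def jump_mean_diff jump_mean_cmult E_const)
  moreover have "\<epsilon> * E (\<lambda>k l. g (a + k) (b + l)) < \<epsilon> * g a b"
    using Lyapunov_decrease[OF ab1(1)] \<epsilon> by (simp add: g_def)
  ultimately show False using sub[OF ab1 Dab] by linarith
qed

text \<open>The upper bound follows by induction on the number of steps, since
  \<open>angle + K * barrier\<close> dominates the start of the recursion and is preserved by it.
  The probabilities for \<open>n\<close> steps approach \<open>h\<close> from below, so the lower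
  bound instead applies the maximum principle to \<open>angle - K * barrier - h\<close>.\<close>

lemma h_approx:
  obtains K where "K > 0"
    "\<And>i j. i \<ge> 1 \<Longrightarrow> j \<ge> 1 \<Longrightarrow> \<bar>h i j - angle i j\<bar> \<le> K * of_int j / (cmod (pos i j))\<^sup>2"
proof -
  obtain K R where K: "K > 0" and R: "R \<ge> 2 * M"
    and far: "\<And>i j. i \<ge> 1 \<Longrightarrow> j \<ge> 1 \<Longrightarrow> cmod (pos i j) \<ge> R \<Longrightarrow>
        \<bar>E (\<lambda>k l. angle (i + k) (j + l)) - angle i j\<bar>
          \<le> K * (barrier i j - E (\<lambda>k l. barrier (i + k) (j + l)))"
    and near: "\<And>i j. i \<ge> 1 \<Longrightarrow> j \<ge> 1 \<Longrightarrow> cmod (pos i j) < R \<Longrightarrow> K * barrier i j \<ge> pi / \<Theta>"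
    by (rule comparison_constants) blast
  have \<Theta>1: "1 \<le> pi / \<Theta>" using \<Theta>_bounds by simp
  have Kb: "K * barrier i j \<ge> 0" if "i \<ge> 0" "j \<ge> 0" "pos i j \<noteq> 0" for i j
    using barrier_nonneg[OF that] K by simp
  have upper: "hit_V_within p n i j \<le> angle i j + K * barrier i j"
    if "i \<ge> 0" "j \<ge> 0" "pos i j \<noteq> 0" for n i j
    using that
  proof (induction n arbitrary: i j)
    case 0
    have "j \<ge> 1" if "i = 0" using 0 that by (auto simp: pos_eq_0_iff)
    then show ?case using angle_bounds(1)[OF 0] Kb[OF 0] angle_vertical by auto
  next
    case (Suc n)
    consider "i = 0" "j \<ge> 1" | "i \<ge> 1" "j = 0" | "i \<ge> 1" "j \<ge> 1" "cmod (pos i j) < R"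
      | "i \<ge> 1" "j \<ge> 1" "cmod (pos i j) \<ge> R"

    proof -
      have "i = 0 \<or> i \<ge> 1" "j = 0 \<or> j \<ge> 1" "\<not> (i = 0 \<and> j = 0)"
        using Suc.prems by (auto simp: pos_eq_0_iff)
      then show ?thesis using that by (meson not_le)
    qed
    then show ?case
    proof cases
      case 1
      then show ?thesis using Kb[OF Suc.prems] angle_vertical by simp
    next
      case 2
      then show ?thesis using Kb[OF Suc.prems] angle_bounds(1)[OF Suc.prems] by simp
    next
      case 3
      then show ?thesis
        using near[OF 3] angle_bounds(1)[OF Suc.prems] \<Theta>1 hit_bounds(2)[of "Suc n" i j] by linarith
    next
      case 4
      have "hit_V_within p (Suc n) i j = E (\<lambda>k l. hit_V_within p n (i + k) (j + l))"
        using 4 by (intro hit_Suc) auto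
      also have "\<dots> \<le> E (\<lambda>k l. angle (i + k) (j + l) + K * barrier (i + k) (j + l))"
      proof (rule E_mono)
        fix k l :: int assume kl: "k \<in> {-1,0,1}" "l \<in> {-1,0,1}"
        then show "hit_V_within p n (i + k) (j + l) \<le> angle (i + k) (j + l) + K * barrier (i + k) (j + l)"
          using 4 R relative_jump(2)[OF _ kl, of i j] by (intro Suc.IH) auto
      qed
      also have "\<dots> \<le> angle i j + K * barrier i j"
        using far[OF 4] by (simp add: jump_mean_add jump_mean_cmult right_diff_distrib)
      finally show ?thesis .
    qed
  qed
  \<comment> \<open>The value at the origin is set by hand, since there the barrier is only the junk value of a division by 0.\<close>
  define D where "D = (\<lambda>i j. if i = 0 \<and> j = 0 then 0 else angle i j - K * barrier i j - h i j)"
  have D_le: "D i j \<le> 0" if "i \<ge> 0" "j \<ge> 0" for i j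
  proof (rule maximum_principle[of D "pi / \<Theta>"])
    fix i j :: int assume ij: "i \<ge> 1" "j \<ge> 1" and pos: "D i j > 0"
    have nz: "pos i j \<noteq> 0" using ij by (simp add: pos_eq_0_iff)
    \<comment> \<open>Inside radius \<open>R\<close> the term \<open>K * barrier i j\<close> exceeds
      any value of the angle, so \<open>D\<close> cannot be positive there.\<close>
    have large: "cmod (pos i j) \<ge> R"
    proof (rule ccontr)
      assume "\<not> R \<le> cmod (pos i j)"
      then have "D i j \<le> 0"
        using near[of i j] angle_bounds(2)[of i j] ij h_bounds[of i j] nz by (simp add: D_def)
      then show False using pos by simp
    qed
    have "D i j = angle i j - K * barrier i j - E (\<lambda>k l. h (i + k) (j + l))"
      using ij h_harmonic[of i j] by (simp add: D_def)
    also have "\<dots> \<le> E (\<lambda>k l. angle (i + k) (j + l) - K * barrier (i + k) (j + l) - h (i + k) (j + l))"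
      using far[OF ij large] by (simp add: jump_mean_diff jump_mean_cmult right_diff_distrib)
    \<comment> \<open>No jump from distance \<open>2 * M\<close> or more reaches the origin, so the
      special value of \<open>D\<close> there does not enter.\<close>
    also have "\<dots> = E (\<lambda>k l. D (i + k) (j + l))"
    proof (rule jump_mean_cong)
      fix k l :: int assume kl: "k \<in> {-1,0,1}" "l \<in> {-1,0,1}"
      then show "angle (i + k) (j + l) - K * barrier (i + k) (j + l) - h (i + k) (j + l) = D (i + k) (j + l)"
        using large R relative_jump(2)[OF _ kl, of i j] by (auto simp: D_def pos_eq_0_iff)
    qed
    finally show "D i j \<le> E (\<lambda>k l. D (i + k) (j + l))" .
  next
    fix i j :: int assume ij: "i \<ge> 0" "j \<ge> 0" "i = 0 \<or> j = 0"
    show "D i j \<le> 0"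
    proof (cases "i = 0 \<and> j = 0")
      case False
      then have "angle i j = (if i = 0 then 1 else 0)"
        using ij angle_vertical[of j] angle_horizontal[of i] by auto
      then show ?thesis
        using Kb[of i j] h_bounds[of i j] h_vertical[of j] ij False by (auto simp: D_def pos_eq_0_iff)
    qed (simp add: D_def)
  next
    fix i j :: int assume "i \<ge> 0" "j \<ge> 0"
    then show "D i j \<le> pi / \<Theta>"
      using angle_bounds(2)[of i j] Kb[of i j] h_bounds[of i j] \<Theta>1 by (auto simp: D_def pos_eq_0_iff)
  qed (use that in auto)
  show ?thesis
  proof
    show "K * (2 * cmod \<beta> + 1) > 0" using K by (intro mult_pos_pos add_nonneg_pos) auto
    show "\<bar>h i j - angle i j\<bar> \<le> K * (2 * cmod \<beta> + 1) * of_int j / (cmod (pos i j))\<^sup>2"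
      if ij: "i \<ge> 1" "j \<ge> 1" for i j
    proof -
      have nz: "pos i j \<noteq> 0" using ij by (simp add: pos_eq_0_iff)
      have "h i j \<le> angle i j + K * barrier i j"
        using ij nz upper by (intro LIMSEQ_le_const2[OF hit_tendsto]) auto
      moreover have "angle i j - K * barrier i j \<le> h i j" using D_le[of i j] ij by (simp add: D_def)
      moreover have "K * barrier i j \<le> K * ((2 * cmod \<beta> + 1) * of_int j / (cmod (pos i j))\<^sup>2)"
        using K ij nz by (intro mult_left_mono barrier_bounds) auto
      ultimately show ?thesis by (simp add: abs_le_iff mult.assoc)
    qed
  qed
qed

section \<open>Asymptotics\<close>

text \<open>Dividing by the positive number \<open>i\<close> leaves \<open>Arg\<close> unchanged and
  gives \<open>1 + q\<close> with \<open>q = \<beta> * j / i\<close>. The linear term of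
  \<open>Ln (1 + q)\<close> yields exactly \<open>Im \<beta> * j\<close> after multiplication by
  \<open>i\<close>; the rest is of order \<open>1 / i\<close>.\<close>

lemma scaled_angle_tendsto:
  fixes j :: nat
  assumes "j \<ge> 1"
  shows "(\<lambda>i. real i * angle (int i) (int j)) \<longlonglongrightarrow> Im \<beta> / \<Theta> * real j"
proof -
  define b where "b = cmod \<beta> * real j"
  have "b \<ge> 0" by (simp add: b_def)
  have *: "\<bar>real i * Arg (pos (int i) (int j)) - Im \<beta> * real j\<bar> \<le> 2 * b\<^sup>2 / real i"
    if i: "i \<ge> 1" "real i \<ge> 2 * b" for i :: nat
  proof -
    define q where "q = \<beta> * of_nat j / of_nat i"
    have q: "cmod q \<le> 1/2" using i by (simp add: q_def norm_mult norm_divide b_def field_simps)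
    have "1 + q \<noteq> 0"
    proof
      assume "1 + q = 0"
      then have "q = -1" by (simp add: add_eq_0_iff)
      then show False using q by simp
    qed
    have "pos (int i) (int j) = of_real (real i) * (1 + q)"
      using i by (simp add: pos_def q_def algebra_simps)
    then have "Arg (pos (int i) (int j)) = Arg (1 + q)"
      using i Arg_times_of_real[of "real i" "1 + q"] by simp
    also have "\<dots> = Im (Ln (1 + q))" using \<open>1 + q \<noteq> 0\<close> by (rule Arg_eq_Im_Ln)
    finally have "real i * Arg (pos (int i) (int j)) - Im \<beta> * real j = real i * Im (Ln (1 + q) - q)"
      using i by (simp add: q_def algebra_simps)
    also have "\<bar>\<dots>\<bar> \<le> real i * cmod (Ln (1 + q) - q)"
      by (simp add: abs_mult abs_Im_le_cmod mult_left_mono del: minus_complex.sel)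
    also have "\<dots> \<le> real i * ((cmod q)\<^sup>2 / (1 - cmod q))"
      using Ln_approx_linear[of q] q by (intro mult_left_mono) auto
    also have "\<dots> \<le> real i * ((cmod q)\<^sup>2 / (1/2))"
      using q by (intro mult_left_mono divide_left_mono) auto
    also have "\<dots> = 2 * b\<^sup>2 / real i"
      using i by (simp add: q_def norm_mult norm_divide b_def power2_eq_square)
    finally show ?thesis .
  qed
  have "(\<lambda>i. real i * Arg (pos (int i) (int j)) - Im \<beta> * real j) \<longlonglongrightarrow> 0"
  proof (rule Lim_null_comparison)
    have "\<forall>\<^sub>F i in sequentially. real i \<ge> 2 * b"
      using filterlim_real_sequentially by (simp add: filterlim_at_top)
    with eventually_ge_at_top[of 1]
    show "\<forall>\<^sub>F i in sequentially. norm (real i * Arg (pos (int i) (int j)) - Im \<beta> * real j) \<le> 2 * b\<^sup>2 / real i"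
      by eventually_elim (use * in auto)
    show "(\<lambda>i. 2 * b\<^sup>2 / real i) \<longlonglongrightarrow> 0" by (rule lim_const_over_n)
  qed
  then have "(\<lambda>i. real i * Arg (pos (int i) (int j))) \<longlonglongrightarrow> Im \<beta> * real j"
    by (rule LIM_zero_cancel)
  then have "(\<lambda>i. real i * Arg (pos (int i) (int j)) / \<Theta>) \<longlonglongrightarrow> Im \<beta> * real j / \<Theta>"
    using \<Theta>_bounds by (intro tendsto_divide) auto
  then show ?thesis by (simp add: angle_def)
qed

text \<open>For \<open>i\<close> at least \<open>2 * cmod \<beta> * j\<close> the modulus of
  \<open>pos i j\<close> is at least \<open>i / 2\<close>, so the error in \<open>h_approx\<close>,
  multiplied by \<open>i\<close>, is still of order \<open>1 / i\<close>.\<close>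

lemma scaled_h_tendsto:
  fixes j :: nat
  assumes j: "j \<ge> 1"
  shows "(\<lambda>i. real i * h (int i) (int j)) \<longlonglongrightarrow> Im \<beta> / \<Theta> * real j"
proof -
  obtain K where K: "K > 0"
    "\<And>i j. i \<ge> 1 \<Longrightarrow> j \<ge> 1 \<Longrightarrow> \<bar>h i j - angle i j\<bar> \<le> K * of_int j / (cmod (pos i j))\<^sup>2"
    by (rule h_approx) blast
  define b where "b = cmod \<beta> * real j"
  have "(\<lambda>i. real i * h (int i) (int j) - real i * angle (int i) (int j)) \<longlonglongrightarrow> 0"
  proof (rule Lim_null_comparison)
    have "\<forall>\<^sub>F i in sequentially. real i \<ge> 2 * b"
      using filterlim_real_sequentially by (simp add: filterlim_at_top)
    with eventually_ge_at_top[of 1]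
    show "\<forall>\<^sub>F i in sequentially. norm (real i * h (int i) (int j) - real i * angle (int i) (int j))
        \<le> (4 * K * real j) / real i"
    proof eventually_elim
      case (elim i)
      have "cmod (pos (int i) (int j)) \<ge> cmod (of_nat i) - cmod (\<beta> * of_nat j)"
        unfolding pos_def using norm_diff_ineq[of "of_nat i" "\<beta> * of_nat j"] by simp
      then have "real i / 2 \<le> cmod (pos (int i) (int j))"
        using elim by (simp add: norm_mult b_def)
      then have sq: "(real i / 2)\<^sup>2 \<le> (cmod (pos (int i) (int j)))\<^sup>2" by (intro power_mono) auto
      have "norm (real i * h (int i) (int j) - real i * angle (int i) (int j))
          = real i * \<bar>h (int i) (int j) - angle (int i) (int j)\<bar>"
        by (simp add: abs_mult flip: right_diff_distrib)
      also have "\<dots> \<le> real i * (K * real j / (cmod (pos (int i) (int j)))\<^sup>2)"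
        using K(2)[of "int i" "int j"] elim j by (intro mult_left_mono) auto
      also have "\<dots> \<le> real i * (K * real j / (real i / 2)\<^sup>2)"
        using sq K(1) elim by (intro mult_left_mono frac_le) auto
      also have "\<dots> = (4 * K * real j) / real i"
        using elim by (simp add: field_simps power2_eq_square)
      finally show ?case .
    qed
    show "(\<lambda>i. (4 * K * real j) / real i) \<longlonglongrightarrow> 0" by (rule lim_const_over_n)
  qed
  from tendsto_add[OF this scaled_angle_tendsto[OF j]] show ?thesis by simp
qed

lemma h_asymp_equiv:
  fixes j :: nat
  assumes j: "j \<ge> 1"
  shows "(\<lambda>i::nat. h (int i) (int j)) \<sim>[at_top] (\<lambda>i::nat. (Im \<beta> / \<Theta>) * real j / real i)"
proof (rule asymp_equivI')
  have "(\<lambda>i. real i * h (int i) (int j) / (Im \<beta> / \<Theta> * real j)) \<longlonglongrightarrow> 1"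
    using tendsto_divide[OF scaled_h_tendsto[OF j] tendsto_const[of "Im \<beta> / \<Theta> * real j"]]
      Im_pos \<Theta>_bounds j by simp
  then show "(\<lambda>i. h (int i) (int j) / (Im \<beta> / \<Theta> * real j / real i)) \<longlonglongrightarrow> 1"
    by (simp add: mult_ac)
qed

end

section \<open>Existence of the isotropic coordinate\<close>

text \<open>Let \<open>d1\<close>, \<open>d2\<close>, \<open>t\<close>, \<open>v\<close> be the jump
  masses on the two diagonals, the horizontal and the vertical line. The covariance determinant is a
  sum of nonnegative products of these and vanishes only if at most one mass is nonzero. All jumps
  would then lie on one line, and each of the four assumptions on triples rules out one such
  line.\<close>

lemma covariance_positive:
  fixes p :: "int \<Rightarrow> int \<Rightarrow> real"
  assumes nonneg: "\<And>k l. k \<in> {-1,0,1} \<Longrightarrow> l \<in> {-1,0,1} \<Longrightarrow> p k l \<ge> 0"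
    and "\<not> (p 1 1 = 0 \<and> p 1 0 = 0 \<and> p 1 (-1) = 0)"
    and "\<not> (p 1 0 = 0 \<and> p 1 (-1) = 0 \<and> p 0 (-1) = 0)"
    and "\<not> (p 1 (-1) = 0 \<and> p 0 (-1) = 0 \<and> p (-1) (-1) = 0)"
    and "\<not> (p 0 (-1) = 0 \<and> p (-1) (-1) = 0 \<and> p (-1) 0 = 0)"
  shows "(jump_mean p (\<lambda>k l. of_int k * of_int l))\<^sup>2
    < jump_mean p (\<lambda>k l. (of_int k)\<^sup>2) * jump_mean p (\<lambda>k l. (of_int l)\<^sup>2)"
proof -
  define d1 where "d1 = p 1 1 + p (-1) (-1)"
  define d2 where "d2 = p 1 (-1) + p (-1) 1"
  define t where "t = p 1 0 + p (-1) 0"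
  define v where "v = p 0 1 + p 0 (-1)"
  have nn: "p 1 1 \<ge> 0" "p 1 0 \<ge> 0" "p 1 (-1) \<ge> 0" "p 0 1 \<ge> 0" "p 0 (-1) \<ge> 0"
    "p (-1) 1 \<ge> 0" "p (-1) 0 \<ge> 0" "p (-1) (-1) \<ge> 0"
    using nonneg by auto
  then have pos: "d1 \<ge> 0" "d2 \<ge> 0" "t \<ge> 0" "v \<ge> 0" by (auto simp: d1_def d2_def t_def v_def)
  have zero: "d1 = 0 \<Longrightarrow> p 1 1 = 0 \<and> p (-1) (-1) = 0" "d2 = 0 \<Longrightarrow> p 1 (-1) = 0 \<and> p (-1) 1 = 0"
    "t = 0 \<Longrightarrow> p 1 0 = 0 \<and> p (-1) 0 = 0" "v = 0 \<Longrightarrow> p 0 1 = 0 \<and> p 0 (-1) = 0"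
    using nn by (auto simp: d1_def d2_def t_def v_def)
  have "4 * (d1 * d2) + (d1 + d2) * (t + v) + t * v \<noteq> 0"
  proof
    assume "4 * (d1 * d2) + (d1 + d2) * (t + v) + t * v = 0"
    moreover have "d1 * d2 \<ge> 0" "(d1 + d2) * (t + v) \<ge> 0" "t * v \<ge> 0" using pos by auto
    ultimately have "d1 * d2 = 0" "(d1 + d2) * (t + v) = 0" "t * v = 0" by linarith+
    then have "d1 = 0 \<or> d2 = 0" "d1 + d2 = 0 \<or> t + v = 0" "t = 0 \<or> v = 0" by auto
    then show False using zero pos assms(2-) by (smt (verit))
  qed
  moreover have "4 * (d1 * d2) + (d1 + d2) * (t + v) + t * v \<ge> 0" using pos by simp
  moreover have "jump_mean p (\<lambda>k l. (of_int k)\<^sup>2) * jump_mean p (\<lambda>k l. (of_int l)\<^sup>2)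
      - (jump_mean p (\<lambda>k l. of_int k * of_int l))\<^sup>2 = 4 * (d1 * d2) + (d1 + d2) * (t + v) + t * v"
  proof -
    have "jump_mean p (\<lambda>k l. (of_int k)\<^sup>2) = d1 + d2 + t" "jump_mean p (\<lambda>k l. (of_int l)\<^sup>2) = d1 + d2 + v"
      "jump_mean p (\<lambda>k l. of_int k * of_int l) = d1 - d2"
      by (simp_all add: jump_mean_def d1_def d2_def t_def v_def)
    then show ?thesis by (simp only:) (simp add: power2_eq_square algebra_simps)
  qed
  ultimately show ?thesis by linarith
qed

text \<open>The real quadratic has negative discriminant; the witness is its root in the upper half
  plane.\<close>

lemma isotropic_direction:
  fixes a b d :: real
  assumes "b\<^sup>2 < a * d" "d \<ge> 0"
  obtains \<beta> :: complex where "Im \<beta> > 0" "of_real a + 2 * \<beta> * of_real b + \<beta>\<^sup>2 * of_real d = 0"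
proof
  define s where "s = sqrt (a * d - b\<^sup>2)"
  have s: "s > 0" "s\<^sup>2 = a * d - b\<^sup>2" using assms by (auto simp: s_def)
  have d: "d > 0" using assms by (cases "d = 0") auto
  show "Im (Complex (- b / d) (s / d)) > 0" using s d by simp
  have r: "a + 2 * (- b / d) * b + ((- b / d)\<^sup>2 - (s / d)\<^sup>2) * d = 0"
    using d unfolding power_divide s(2) by (simp add: field_simps power2_eq_square)
  have i: "2 * (s / d) * b + 2 * (- b / d) * (s / d) * d = 0"
    using d by (simp add: field_simps)
  show "of_real a + 2 * Complex (- b / d) (s / d) * of_real b + (Complex (- b / d) (s / d))\<^sup>2 * of_real d = 0"
    using r i by (simp add: complex_eq_iff power2_eq_square)
qed

theorem theorem1:
  fixes p :: "int \<Rightarrow> int \<Rightarrow> real"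
  assumes nonneg: "\<And>k l. k \<in> {-1,0,1} \<Longrightarrow> l \<in> {-1,0,1} \<Longrightarrow> p k l \<ge> 0"
    and total: "(\<Sum>k\<in>{-1,0,1}. \<Sum>l\<in>{-1,0,1}. p k l) = 1"
    and H2: "let L = [p 1 1, p 1 0, p 1 (-1), p 0 (-1), p (-1) (-1), p (-1) 0, p (-1) 1, p 0 1]
             in \<not> (\<exists>m. m + 2 < length L \<and> L ! m = 0 \<and> L ! (m+1) = 0 \<and> L ! (m+2) = 0)"
    and H3: "p 1 1 + p (-1) 1 + p (-1) (-1) + p 1 (-1) < 1"
    and drift_x: "(\<Sum>k\<in>{-1,0,1}. \<Sum>l\<in>{-1,0,1}. real_of_int k * p k l) = 0"
    and drift_y: "(\<Sum>k\<in>{-1,0,1}. \<Sum>l\<in>{-1,0,1}. real_of_int l * p k l) = 0"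
  shows "\<exists>A::real. 0 < A \<and>
           (\<forall>j0::nat. j0 \<ge> 1 \<longrightarrow>
              ((\<lambda>i0::nat. hit_V_before_H p (int i0) (int j0))
                 \<sim>[at_top] (\<lambda>i0::nat. A * real j0 / real i0)))"
proof -
  \<comment> \<open>The windows of (H2) starting at positions 0 to 3.\<close>
  have no_zeros: "\<not> (p 1 1 = 0 \<and> p 1 0 = 0 \<and> p 1 (-1) = 0)"
    "\<not> (p 1 0 = 0 \<and> p 1 (-1) = 0 \<and> p 0 (-1) = 0)"
    "\<not> (p 1 (-1) = 0 \<and> p 0 (-1) = 0 \<and> p (-1) (-1) = 0)"
    "\<not> (p 0 (-1) = 0 \<and> p (-1) (-1) = 0 \<and> p (-1) 0 = 0)"
    using H2 unfolding Let_def not_ex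
    by (auto dest: spec[of _ 0] spec[of _ 1] spec[of _ 2] spec[of _ 3] simp: eval_nat_numeral)
  note cov = covariance_positive[OF nonneg no_zeros]
  have "jump_mean p (\<lambda>k l. (of_int l)\<^sup>2) \<ge> 0"
    unfolding jump_mean_def by (intro sum_nonneg mult_nonneg_nonneg nonneg) auto
  then obtain \<beta> :: complex where \<beta>: "Im \<beta> > 0"
    "of_real (jump_mean p (\<lambda>k l. (of_int k)\<^sup>2)) + 2 * \<beta> * of_real (jump_mean p (\<lambda>k l. of_int k * of_int l))
        + \<beta>\<^sup>2 * of_real (jump_mean p (\<lambda>k l. (of_int l)\<^sup>2)) = 0"
    using isotropic_direction[OF cov] by blast
  interpret centred_walk p \<beta>
  proof
    have "p 1 1 \<ge> 0" "p 1 0 \<ge> 0" "p 1 (-1) \<ge> 0" by (auto intro: nonneg)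
    then show "p 1 1 + p 1 0 + p 1 (-1) > 0" using no_zeros(1) by linarith
  qed (use nonneg total drift_x drift_y \<beta> in \<open>simp_all add: jump_mean_def mult.commute\<close>)
  \<comment> \<open>The constant depends on \<open>p\<close> only through \<open>\<beta>\<close>,
    hence is the same for every \<open>j0\<close>.\<close>
  show ?thesis
    using h_asymp_equiv \<Theta>_bounds Im_pos by (intro exI[of _ "Im \<beta> / \<Theta>"]) auto
qed

end
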